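(* Consider the fully composite problem $\varphi^*=\min_{x\in\operatorname{dom}\varphi}\{\varphi(x)=F(x,f(x))\}$ with subhomogeneous outer function (see context), where each component of $f$ is convex and twice continuously differentiable with Lipschitz continuous Hessian, and $F(L_2(f))<+\infty$. Let $\operatorname{dom}\varphi$ be bounded, with diameter $$\mathscr{D}=\sup_{x,y\in\operatorname{dom}\varphi}\|x-y\|<+\infty.$$ Let $x_0\in\operatorname{dom}\varphi$, $\gamma_k=\frac{3}{k+3}$, and let $\{x_k\}$ be generated by the Fully Composite Contracting Newton Method $$x_{k+1}\in\operatorname*{argmin}_{y}\Big\{F\big(y,\ \Omega_2(f,x_k;y)\big):\ x_k+\tfrac1{\gamma_k}(y-x_k)\in\operatorname{dom}\varphi\Big\},\qquad k\ge0$$ (minimizers are assumed to exist). Then for all $k\ge1$, $$\varphi(x_k)-\varphi^*\ \le\ \frac{9F(L_2(f))\mathscr{D}^3}{k^2}.$$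
   Context: $\mathbb{E}$ is a finite-dimensional real vector space with norm $\|x\|=\langle Bx,x\rangle^{1/2}$, where $B:\mathbb{E}\to\mathbb{E}^*$ is self-adjoint positive definite. Fully composite problem: $F:\mathbb{E}\times\mathbb{R}^m\to\mathbb{R}\cup\{+\infty\}$ is closed and convex, and for every $x$ the function $F(x,\cdot)$ is monotone: $u\le v$ componentwise implies $F(x,u)\le F(x,v)$. $f=(f_1,\dots,f_m)^T:\operatorname{dom} f\to\mathbb{R}^m$ with $\operatorname{dom} f\subseteq\mathbb{E}$ open convex, and all $f_i$ closed and convex. $\varphi(x)=F(x,f(x))$, $\operatorname{dom}\varphi=\{x\in\operatorname{dom} f:F(x,f(x))<+\infty\}$, and a minimizer $x^*$ with $\varphi(x^* )=\varphi^*$ is assumed to exist. Subhomogeneity: for every $x\in\operatorname{dom}\varphi$, $F(x,\cdot)$ is finite on all of $\mathbb{R}^m$ and $F(x,u+tv)\le F(x,u)+tF(x,v)$ for all $u,v\in\mathbb{R}^m$, $t\ge0$. $\Omega_2(f,x;y)=f(x)+\langle\nabla f(x),y-x\rangle+\frac12\langle\nabla^2f(x)(y-x),y-x\rangle$ (componentwise). $L_2(f_i)<+\infty$ is a constant with $\|\nabla^2f_i(x)-\nabla^2f_i(y)\|\le L_2(f_i)\|x-y\|$ on $\operatorname{dom} f$, where $\|H\|=\max\{\langle Hh_1,h_2\rangle:\|h_1\|,\|h_2\|\le1\}$; $L_2(f)=(L_2(f_1),\dots,L_2(f_m))^T$. Notation: $F(L_2(f))=\sup_{x\in\operatorname{dom}\varphi}F(x,L_2(f))$.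 *)

theory Defs
  imports "HOL-Analysis.Analysis"
begin

text \<open>
  The finite-dimensional space is an arbitrary type of class \<open>euclidean_space\<close>, which serves
  only as a coordinate space: its own norm and inner product enter solely through the topology.
  The dual space is the type \<open>'a \<Rightarrow>\<^sub>L real\<close>, so that gradients have this type, and \<open>B\<close> and the
  Hessians are linear maps from the space to its dual.  The norm used for the Lipschitz
  constants and for the diameter is the one induced by \<open>B\<close>.
\<close>

definition self_adjoint_pos_def :: "('a::euclidean_space \<Rightarrow>\<^sub>L 'a \<Rightarrow>\<^sub>L real) \<Rightarrow> bool" where
  "self_adjoint_pos_def B \<longleftrightarrow>
     (\<forall>x y. blinfun_apply (blinfun_apply B x) y = blinfun_apply (blinfun_apply B y) x) \<and>
     (\<forall>x. x \<noteq> 0 \<longrightarrow> blinfun_apply (blinfun_apply B x) x > 0)"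

definition B_norm :: "('a::euclidean_space \<Rightarrow>\<^sub>L 'a \<Rightarrow>\<^sub>L real) \<Rightarrow> 'a \<Rightarrow> real" where
  "B_norm B x = sqrt (blinfun_apply (blinfun_apply B x) x)"

text \<open>For \<open>B\<close> positive definite the supremum below is over a nonempty bounded set, and is attained.\<close>

definition B_opnorm ::
  "('a::euclidean_space \<Rightarrow>\<^sub>L 'a \<Rightarrow>\<^sub>L real) \<Rightarrow> ('a \<Rightarrow>\<^sub>L 'a \<Rightarrow>\<^sub>L real) \<Rightarrow> real" where
  "B_opnorm B H =
     Sup {blinfun_apply (blinfun_apply H h1) h2 | h1 h2. B_norm B h1 \<le> 1 \<and> B_norm B h2 \<le> 1}"

definition B_diameter :: "('a::euclidean_space \<Rightarrow>\<^sub>L 'a \<Rightarrow>\<^sub>L real) \<Rightarrow> 'a set \<Rightarrow> ereal" where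
  "B_diameter B S = (SUP x\<in>S. SUP y\<in>S. ereal (B_norm B (x - y)))"

definition ereal_epigraph :: "('b \<Rightarrow> ereal) \<Rightarrow> ('b \<times> real) set" where
  "ereal_epigraph F = {(z, t). F z \<le> ereal t}"

definition closed_convex_ereal :: "('b::euclidean_space \<Rightarrow> ereal) \<Rightarrow> bool" where
  "closed_convex_ereal F \<longleftrightarrow>
     (\<forall>z. F z \<noteq> -\<infinity>) \<and> closed (ereal_epigraph F) \<and> convex (ereal_epigraph F)"

definition twice_continuously_differentiable_on ::
  "'a::euclidean_space set \<Rightarrow> ('a \<Rightarrow> real) \<Rightarrow> ('a \<Rightarrow> 'a \<Rightarrow>\<^sub>L real) \<Rightarrow> ('a \<Rightarrow> 'a \<Rightarrow>\<^sub>L 'a \<Rightarrow>\<^sub>L real) \<Rightarrow> bool"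
where
  "twice_continuously_differentiable_on D f grad hess \<longleftrightarrow>
     (\<forall>x\<in>D. (f has_derivative blinfun_apply (grad x)) (at x)) \<and>
     (\<forall>x\<in>D. (grad has_derivative blinfun_apply (hess x)) (at x)) \<and>
     continuous_on D hess"

text \<open>The inner map is a total function, meaningful only on its domain \<open>D\<close>; outside of \<open>D\<close>
  the composite objective is \<open>\<infinity>\<close>.\<close>

definition composite ::
  "('a \<times> (real ^ 'm) \<Rightarrow> ereal) \<Rightarrow> 'a set \<Rightarrow> ('a \<Rightarrow> real ^ 'm) \<Rightarrow> 'a \<Rightarrow> ereal" where
  "composite F D f x = (if x \<in> D then F (x, f x) else \<infinity>)"

definition composite_dom ::
  "('a \<times> (real ^ 'm) \<Rightarrow> ereal) \<Rightarrow> 'a set \<Rightarrow> ('a \<Rightarrow> real ^ 'm) \<Rightarrow> 'a set" where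
  "composite_dom F D f = {x \<in> D. F (x, f x) < \<infinity>}"

definition subhomogeneous_on :: "'a set \<Rightarrow> ('a \<times> (real ^ 'm) \<Rightarrow> ereal) \<Rightarrow> bool" where
  "subhomogeneous_on S F \<longleftrightarrow>
     (\<forall>x\<in>S. (\<forall>u. \<bar>F (x, u)\<bar> \<noteq> \<infinity>) \<and>
        (\<forall>u v. \<forall>t\<ge>0. F (x, u + t *\<^sub>R v) \<le> F (x, u) + ereal t * F (x, v)))"

definition Omega2 ::
  "('a::euclidean_space \<Rightarrow> real ^ 'm) \<Rightarrow> ('m \<Rightarrow> 'a \<Rightarrow> 'a \<Rightarrow>\<^sub>L real) \<Rightarrow>
   ('m \<Rightarrow> 'a \<Rightarrow> 'a \<Rightarrow>\<^sub>L 'a \<Rightarrow>\<^sub>L real) \<Rightarrow> 'a \<Rightarrow> 'a \<Rightarrow> real ^ 'm" where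
  "Omega2 f grad hess x y =
     (\<chi> i. f x $ i + blinfun_apply (grad i x) (y - x) +
           1 / 2 * blinfun_apply (blinfun_apply (hess i x) (y - x)) (y - x))"

end

theory Submission
  imports Defs
begin

text \<open>
  Write \<open>C = F(L\<^sub>2(f)) \<D>\<^sup>3\<close> and let \<open>\<delta>\<^sub>k\<close> be the gap \<open>\<phi>(x\<^sub>k) - \<phi>\<^sup>*\<close>.  The second-order Taylor model
  of each component of \<open>f\<close> errs by at most \<open>L\<^sub>2(f\<^sub>i) \<parallel>y - x\<parallel>\<^sup>3 / 6\<close>, in both directions
  (\<open>second_order_Taylor_error\<close>).  Monotonicity and subhomogeneity of the outer function turn such a
  componentwise error into an additive error \<open>\<parallel>y - x\<parallel>\<^sup>3 F(y, L\<^sub>2(f)) / 6\<close> of the objective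
  (\<open>subhomogeneous_perturbation\<close>).

  The feasible points of a step are exactly \<open>x\<^sub>k + \<gamma>\<^sub>k (v - x\<^sub>k)\<close> with \<open>v\<close> in the domain of \<open>\<phi>\<close>, so every
  feasible point, the new iterate included, is within \<open>\<gamma>\<^sub>k \<D>\<close> of \<open>x\<^sub>k\<close>.  The model overestimates \<open>\<phi>\<close>
  at the competitor \<open>x\<^sub>k + \<gamma>\<^sub>k (x\<^sup>* - x\<^sub>k)\<close> by at most \<open>\<gamma>\<^sub>k\<^sup>3 C / 6\<close>, underestimates it at \<open>x\<^bsub>k+1\<^esub>\<close> by
  at most the same amount, and \<open>\<phi>\<close> is convex (\<open>composite_convex\<close>).  Hence
  (\<open>contracting_Newton_step\<close>)
  \<open>\<delta>\<^bsub>k+1\<^esub> \<le> (1 - \<gamma>\<^sub>k) \<delta>\<^sub>k + \<gamma>\<^sub>k\<^sup>3 C / 3\<close>.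

  With \<open>\<gamma>\<^sub>k = 3 / (k + 3)\<close> the factor \<open>1 - \<gamma>\<^sub>k = k / (k + 3)\<close> is the quotient of the weights
  \<open>k (k + 1) (k + 2)\<close> at \<open>k\<close> and \<open>k + 1\<close>, so the weighted gaps grow by at most \<open>9 C\<close> in each step
  (\<open>contracting_recursion\<close>).  Since the first weight is zero, \<open>\<delta>\<^sub>k \<le> 9 C / ((k + 1) (k + 2))\<close>.
\<close>

section \<open>The norm induced by a positive definite operator\<close>

lemma B_norm_scaleR: "B_norm B (c *\<^sub>R x) = \<bar>c\<bar> * B_norm B x"
proof -
  have "blinfun_apply (blinfun_apply B (c *\<^sub>R x)) (c *\<^sub>R x) = c\<^sup>2 * blinfun_apply (blinfun_apply B x) x"
    by (simp add: blinfun.scaleR_left blinfun.scaleR_right power2_eq_square)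
  then show ?thesis
    by (simp add: B_norm_def real_sqrt_mult)
qed

lemma B_norm_pos:
  assumes "self_adjoint_pos_def B" "x \<noteq> 0"
  shows "B_norm B x > 0"
  using assms by (simp add: B_norm_def self_adjoint_pos_def_def)

lemma B_norm_nonneg:
  assumes "self_adjoint_pos_def B"
  shows "B_norm B x \<ge> 0"
  using B_norm_pos[OF assms, of x] by (cases "x = 0") (auto simp: B_norm_def)

text \<open>By compactness of the Euclidean unit sphere the \<open>B\<close>-norm dominates the Euclidean norm.\<close>

lemma B_norm_dominates_norm:
  fixes B :: "'a::euclidean_space \<Rightarrow>\<^sub>L 'a \<Rightarrow>\<^sub>L real"
  assumes "self_adjoint_pos_def B"
  obtains c where "c > 0" "\<And>x. c * norm x \<le> B_norm B x"
proof -
  obtain b :: 'a where b: "b \<in> Basis"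
    using nonempty_Basis by blast
  have "continuous_on (sphere 0 1) (B_norm B)"
    unfolding B_norm_def by (intro continuous_intros)
  moreover have "sphere (0::'a) 1 \<noteq> {}"
    using norm_Basis[OF b] by (force simp: sphere_def dist_norm)
  ultimately obtain s where s: "s \<in> sphere 0 1" "\<And>y. y \<in> sphere 0 1 \<Longrightarrow> B_norm B s \<le> B_norm B y"
    using continuous_attains_inf[OF compact_sphere] by blast
  have "B_norm B s * norm x \<le> B_norm B x" for x
  proof (cases "x = 0")
    case False
    have "B_norm B s \<le> B_norm B ((1 / norm x) *\<^sub>R x)"
      using False by (intro s(2)) simp
    then show ?thesis
      using False by (simp only: B_norm_scaleR) (simp add: field_simps)
  qed (use B_norm_nonneg[OF assms] in simp)
  moreover have "B_norm B s > 0"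
    using s(1) by (intro B_norm_pos[OF assms]) auto
  ultimately show thesis
    using that by blast
qed

text \<open>The supremum defining the operator norm is an upper bound only because its range is bounded,
  which is where domination of the Euclidean norm enters.\<close>

lemma le_B_opnorm:
  fixes B :: "'a::euclidean_space \<Rightarrow>\<^sub>L 'a \<Rightarrow>\<^sub>L real"
  assumes "self_adjoint_pos_def B" "B_norm B u \<le> 1" "B_norm B v \<le> 1"
  shows "blinfun_apply (blinfun_apply H u) v \<le> B_opnorm B H"
proof -
  obtain c where c: "c > 0" "\<And>x. c * norm x \<le> B_norm B x"
    using B_norm_dominates_norm[OF assms(1)] by blast
  have small: "norm w \<le> 1 / c" if "B_norm B w \<le> 1" for w
    using c(1) order_trans[OF c(2) that] by (simp add: field_simps)
  have "blinfun_apply (blinfun_apply H h1) h2 \<le> norm H * (1 / c) * (1 / c)"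
    if "B_norm B h1 \<le> 1" "B_norm B h2 \<le> 1" for h1 h2
  proof -
    have "blinfun_apply (blinfun_apply H h1) h2 \<le> norm (blinfun_apply H h1) * norm h2"
      using norm_blinfun[of "blinfun_apply H h1" h2] by simp
    also have "\<dots> \<le> (norm H * norm h1) * norm h2"
      by (intro mult_right_mono norm_blinfun) simp
    also have "\<dots> \<le> (norm H * (1 / c)) * (1 / c)"
      using small[OF that(1)] small[OF that(2)] c(1) by (intro mult_mono) auto
    finally show ?thesis .
  qed
  then have "bdd_above {blinfun_apply (blinfun_apply H h1) h2 | h1 h2. B_norm B h1 \<le> 1 \<and> B_norm B h2 \<le> 1}"
    by (intro bdd_aboveI) blast
  then show ?thesis
    unfolding B_opnorm_def using assms(2,3) by (intro cSup_upper) auto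
qed

lemma B_opnorm_nonneg:
  assumes "self_adjoint_pos_def B"
  shows "B_opnorm B H \<ge> 0"
  using le_B_opnorm[OF assms, of 0 0 H] by (simp add: B_norm_def)

lemma quadratic_form_le_B_opnorm:
  assumes "self_adjoint_pos_def B"
  shows "blinfun_apply (blinfun_apply H h) h \<le> B_opnorm B H * (B_norm B h)\<^sup>2"
proof (cases "h = 0")
  case False
  let ?n = "B_norm B h"
  have n: "?n > 0"
    using B_norm_pos[OF assms False] .
  then have "B_norm B ((1 / ?n) *\<^sub>R h) \<le> 1"
    by (simp only: B_norm_scaleR) simp
  from le_B_opnorm[OF assms this this, of H] show ?thesis
    using n by (simp add: blinfun.scaleR_left blinfun.scaleR_right field_simps power2_eq_square)
qed (simp add: B_norm_def)

section \<open>Error of the second-order Taylor model\<close>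

text \<open>Integrating \<open>p'' \<le> M s\<close> twice from zero gives \<open>p(s) \<le> M s\<^sup>3 / 6\<close>; each integration is a
  monotonicity argument for the difference of the two sides.\<close>

lemma cubic_growth_from_second_derivative:
  fixes p p' p'' :: "real \<Rightarrow> real"
  assumes p: "\<And>s. 0 \<le> s \<Longrightarrow> s \<le> 1 \<Longrightarrow> (p has_real_derivative p' s) (at s)"
    and p': "\<And>s. 0 \<le> s \<Longrightarrow> s \<le> 1 \<Longrightarrow> (p' has_real_derivative p'' s) (at s)"
    and p'': "\<And>s. 0 \<le> s \<Longrightarrow> s \<le> 1 \<Longrightarrow> p'' s \<le> M * s"
    and zero: "p 0 = 0" "p' 0 = 0"
  shows "p 1 \<le> M / 6"
proof -
  have slope: "p' t \<le> M * t\<^sup>2 / 2" if t: "0 \<le> t" "t \<le> 1" for t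
  proof -
    have "M * 0\<^sup>2 / 2 - p' 0 \<le> M * t\<^sup>2 / 2 - p' t"
    proof (rule DERIV_nonneg_imp_nondecreasing[OF t(1), of "\<lambda>s. M * s\<^sup>2 / 2 - p' s"])
      fix s assume "0 \<le> s" "s \<le> t"
      with t have s: "0 \<le> s" "s \<le> 1" by auto
      have "((\<lambda>s. M * s\<^sup>2 / 2 - p' s) has_real_derivative M * s - p'' s) (at s)"
        by (auto intro!: derivative_eq_intros p'[OF s])
      with p''[OF s] show "\<exists>y. ((\<lambda>s. M * s\<^sup>2 / 2 - p' s) has_real_derivative y) (at s) \<and> 0 \<le> y"
        by force
    qed
    with zero show ?thesis by simp
  qed
  have "M * 0 ^ 3 / 6 - p 0 \<le> M * 1 ^ 3 / 6 - p 1"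
  proof (rule DERIV_nonneg_imp_nondecreasing[of 0 1 "\<lambda>s. M * s ^ 3 / 6 - p s"])
    fix s :: real assume s: "0 \<le> s" "s \<le> 1"
    have "((\<lambda>s. M * s ^ 3 / 6 - p s) has_real_derivative M * s\<^sup>2 / 2 - p' s) (at s)"
      by (auto intro!: derivative_eq_intros p[OF s])
    with slope[OF s] show "\<exists>y. ((\<lambda>s. M * s ^ 3 / 6 - p s) has_real_derivative y) (at s) \<and> 0 \<le> y"
      by force
  qed simp
  with zero show ?thesis by simp
qed

text \<open>Along the segment from \<open>x\<close> to \<open>y\<close>, the error of the model vanishes to second order at \<open>x\<close> and
  its second derivative is a Hessian difference, of size at most \<open>s L \<parallel>y - x\<parallel>\<^sup>3\<close>.  The same holds for
  the negated error.\<close>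

lemma second_order_Taylor_error:
  fixes g :: "'a::euclidean_space \<Rightarrow> real"
  assumes B: "self_adjoint_pos_def B"
    and D: "convex D"
    and C2: "twice_continuously_differentiable_on D g grad hess"
    and Lip: "\<And>x y. x \<in> D \<Longrightarrow> y \<in> D \<Longrightarrow> B_opnorm B (hess x - hess y) \<le> L * B_norm B (x - y)"
    and xy: "x \<in> D" "y \<in> D"
  shows "\<bar>g y - (g x + blinfun_apply (grad x) (y - x)
           + 1 / 2 * blinfun_apply (blinfun_apply (hess x) (y - x)) (y - x))\<bar>
         \<le> L * B_norm B (y - x) ^ 3 / 6"
proof -
  define h where "h = y - x"
  define M where "M = L * B_norm B h ^ 3"
  define p where "p = (\<lambda>s. g (x + s *\<^sub>R h) - g x - s * blinfun_apply (grad x) h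
                          - s\<^sup>2 / 2 * blinfun_apply (blinfun_apply (hess x) h) h)"
  define p' where "p' = (\<lambda>s. blinfun_apply (grad (x + s *\<^sub>R h)) h - blinfun_apply (grad x) h
                          - s * blinfun_apply (blinfun_apply (hess x) h) h)"
  define p'' where "p'' = (\<lambda>s. blinfun_apply (blinfun_apply (hess (x + s *\<^sub>R h)) h) h
                          - blinfun_apply (blinfun_apply (hess x) h) h)"
  have seg: "x + s *\<^sub>R h \<in> D" if "0 \<le> s" "s \<le> 1" for s
    using convexD_alt[OF D xy that] by (simp add: h_def algebra_simps)
  have line: "((\<lambda>s. x + s *\<^sub>R h) has_derivative (\<lambda>t. t *\<^sub>R h)) (at s)" for s
    by (auto intro!: derivative_eq_intros)
  have p: "(p has_real_derivative p' s) (at s)" if s: "0 \<le> s" "s \<le> 1" for s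
  proof -
    have "(g has_derivative blinfun_apply (grad (x + s *\<^sub>R h))) (at (x + s *\<^sub>R h))"
      using C2 seg[OF s] by (simp add: twice_continuously_differentiable_on_def)
    from has_derivative_compose[OF line this]
    have "((\<lambda>s. g (x + s *\<^sub>R h)) has_real_derivative blinfun_apply (grad (x + s *\<^sub>R h)) h) (at s)"
      by (simp add: has_field_derivative_def blinfun.scaleR_right mult.commute[of _ "blinfun_apply _ _"])
    then show ?thesis
      unfolding p_def p'_def by (auto intro!: derivative_eq_intros)
  qed
  have p': "(p' has_real_derivative p'' s) (at s)" if s: "0 \<le> s" "s \<le> 1" for s
  proof -
    have "(grad has_derivative blinfun_apply (hess (x + s *\<^sub>R h))) (at (x + s *\<^sub>R h))"
      using C2 seg[OF s] by (simp add: twice_continuously_differentiable_on_def)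
    from has_derivative_compose[OF line this]
    have "((\<lambda>s. grad (x + s *\<^sub>R h)) has_derivative
            (\<lambda>t. blinfun_apply (hess (x + s *\<^sub>R h)) (t *\<^sub>R h))) (at s)" .
    then have "((\<lambda>s. blinfun_apply (grad (x + s *\<^sub>R h)) h) has_derivative
            (\<lambda>t. blinfun_apply (blinfun_apply (hess (x + s *\<^sub>R h)) (t *\<^sub>R h)) h)) (at s)"
      by (auto intro!: derivative_eq_intros)
    then have "((\<lambda>s. blinfun_apply (grad (x + s *\<^sub>R h)) h) has_real_derivative
            blinfun_apply (blinfun_apply (hess (x + s *\<^sub>R h)) h) h) (at s)"
      by (simp add: has_field_derivative_def blinfun.scaleR_right blinfun.scaleR_left
            mult.commute[of _ "blinfun_apply _ _"])
    then show ?thesis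
      unfolding p'_def p''_def by (auto intro!: derivative_eq_intros)
  qed
  \<comment> \<open>stated for two points \<open>a\<close> and \<open>b\<close> so that exchanging them bounds \<open>- p''\<close>\<close>
  have form: "blinfun_apply (blinfun_apply (hess a) h) h - blinfun_apply (blinfun_apply (hess b) h) h \<le> M * s"
    if "a \<in> D" "b \<in> D" "B_norm B (a - b) = s * B_norm B h" for a b s
  proof -
    have "blinfun_apply (blinfun_apply (hess a - hess b) h) h \<le> B_opnorm B (hess a - hess b) * (B_norm B h)\<^sup>2"
      by (rule quadratic_form_le_B_opnorm[OF B])
    also have "\<dots> \<le> (L * (s * B_norm B h)) * (B_norm B h)\<^sup>2"
      using Lip[OF that(1,2)] by (intro mult_right_mono) (simp_all add: that(3))
    finally show ?thesis
      by (simp add: M_def blinfun.diff_left power2_eq_square power3_eq_cube mult_ac)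
  qed
  have dist: "B_norm B (x + s *\<^sub>R h - x) = s * B_norm B h" "B_norm B (x - (x + s *\<^sub>R h)) = s * B_norm B h"
    if "0 \<le> s" for s
    using that B_norm_scaleR[of B s h] B_norm_scaleR[of B "-s" h] by simp_all
  have "p 1 \<le> M / 6"
  proof (rule cubic_growth_from_second_derivative[OF p p'])
    show "p'' s \<le> M * s" if "0 \<le> s" "s \<le> 1" for s
      unfolding p''_def using form[OF seg[OF that] xy(1) dist(1)[OF that(1)]] .
  qed (simp_all add: p_def p'_def)
  moreover have "- p 1 \<le> M / 6"
  proof (rule cubic_growth_from_second_derivative[of "\<lambda>s. - p s" "\<lambda>s. - p' s" "\<lambda>s. - p'' s"])
    show "- p'' s \<le> M * s" if "0 \<le> s" "s \<le> 1" for s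
      unfolding p''_def using form[OF xy(1) seg[OF that] dist(2)[OF that(1)]] by simp
  qed (auto intro!: DERIV_minus p p', simp_all add: p_def p'_def)
  ultimately have "\<bar>p 1\<bar> \<le> M / 6"
    by simp
  then show ?thesis
    by (simp add: p_def M_def h_def algebra_simps)
qed

text \<open>An open set in a space of positive dimension contains two distinct points, so a Lipschitz
  constant of the Hessian there cannot be negative.\<close>

lemma Lipschitz_constant_nonneg:
  fixes D :: "'a::euclidean_space set"
  assumes B: "self_adjoint_pos_def B"
    and D: "open D" "D \<noteq> {}"
    and Lip: "\<And>x y. x \<in> D \<Longrightarrow> y \<in> D \<Longrightarrow> B_opnorm B (H x - H y) \<le> L * B_norm B (x - y)"
  shows "L \<ge> 0"
proof -
  obtain x where x: "x \<in> D"
    using D by blast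
  obtain y where y: "y \<in> D" "y \<noteq> x"
    using islimpt_UNIV[of x] D(1) x unfolding islimpt_def by blast
  have "0 \<le> L * B_norm B (x - y)"
    using B_opnorm_nonneg[OF B] Lip[OF x y(1)] order_trans by blast
  then show ?thesis
    using B_norm_pos[OF B, of "x - y"] y(2) by (simp add: zero_le_mult_iff)
qed

section \<open>The composite objective\<close>

text \<open>Componentwise convexity of the inner map puts \<open>f z\<close> below the convex combination of values, and
  monotonicity transfers this to the outer function.  Real upper bounds \<open>a\<close> and \<open>b\<close> avoid extended
  arithmetic.\<close>

lemma composite_convex:
  fixes F :: "'a::euclidean_space \<times> (real ^ 'm) \<Rightarrow> ereal"
  assumes F: "closed_convex_ereal F"
    and mono: "\<And>x u v. u \<le> v \<Longrightarrow> F (x, u) \<le> F (x, v)"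
    and f: "\<And>i. convex_on D (\<lambda>x. f x $ i)"
    and xy: "x \<in> D" "y \<in> D" "F (x, f x) \<le> ereal a" "F (y, f y) \<le> ereal b"
    and t: "0 \<le> t" "t \<le> 1"
  shows "F ((1 - t) *\<^sub>R x + t *\<^sub>R y, f ((1 - t) *\<^sub>R x + t *\<^sub>R y)) \<le> ereal ((1 - t) * a + t * b)"
proof -
  let ?z = "(1 - t) *\<^sub>R x + t *\<^sub>R y"
  have "(1 - t) *\<^sub>R ((x, f x), a) + t *\<^sub>R ((y, f y), b) \<in> ereal_epigraph F"
    using F xy t unfolding closed_convex_ereal_def
    by (intro convexD_alt) (auto simp: ereal_epigraph_def)
  then have "F (?z, (1 - t) *\<^sub>R f x + t *\<^sub>R f y) \<le> ereal ((1 - t) * a + t * b)"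
    by (simp add: ereal_epigraph_def)
  moreover have "f ?z \<le> (1 - t) *\<^sub>R f x + t *\<^sub>R f y"
    using convex_onD[OF f t xy(1,2)] by (simp add: less_eq_vec_def)
  ultimately show ?thesis
    using mono order_trans by blast
qed

lemma convex_composite_dom:
  fixes F :: "'a::euclidean_space \<times> (real ^ 'm) \<Rightarrow> ereal"
  assumes F: "closed_convex_ereal F"
    and mono: "\<And>x u v. u \<le> v \<Longrightarrow> F (x, u) \<le> F (x, v)"
    and D: "convex D"
    and f: "\<And>i. convex_on D (\<lambda>x. f x $ i)"
  shows "convex (composite_dom F D f)"
  unfolding convex_alt
proof (intro ballI allI impI)
  fix x y t
  assume xy: "x \<in> composite_dom F D f" "y \<in> composite_dom F D f" and t: "(0::real) \<le> t \<and> t \<le> 1"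
  have bound: "\<exists>a. F (z, f z) \<le> ereal a" if "z \<in> composite_dom F D f" for z
    using that by (cases "F (z, f z)") (auto simp: composite_dom_def)
  obtain a b where "F (x, f x) \<le> ereal a" "F (y, f y) \<le> ereal b"
    using bound[OF xy(1)] bound[OF xy(2)] by blast
  with xy t have "F ((1 - t) *\<^sub>R x + t *\<^sub>R y, f ((1 - t) *\<^sub>R x + t *\<^sub>R y)) \<le> ereal ((1 - t) * a + t * b)"
    by (intro composite_convex[OF F mono f]) (auto simp: composite_dom_def)
  also have "\<dots> < \<infinity>" by simp
  finally show "(1 - t) *\<^sub>R x + t *\<^sub>R y \<in> composite_dom F D f"
    using xy t convexD_alt[OF D, of x y t] by (auto simp: composite_dom_def)
qed

text \<open>An error of at most \<open>t l\<close> in the inner value costs at most \<open>t F(z, l)\<close> in the outer one: monotonicity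
  passes to the worst case \<open>u + t l\<close>, and subhomogeneity splits it.\<close>

lemma subhomogeneous_perturbation:
  assumes "subhomogeneous_on S F" "z \<in> S"
    and mono: "\<And>x u v. u \<le> v \<Longrightarrow> F (x, u) \<le> F (x, v)"
    and "w \<le> u + t *\<^sub>R l" "t \<ge> 0" "F (z, u) \<le> ereal c" "F (z, l) \<le> ereal K"
  shows "F (z, w) \<le> ereal (c + t * K)"
proof -
  have "F (z, w) \<le> F (z, u + t *\<^sub>R l)"
    by (intro mono assms)
  also have "\<dots> \<le> F (z, u) + ereal t * F (z, l)"
    using assms unfolding subhomogeneous_on_def by blast
  also have "\<dots> \<le> ereal c + ereal t * ereal K"
    using assms by (intro add_mono ereal_mult_left_mono) auto
  finally show ?thesis by simp
qed

text \<open>Adding \<open>l \<ge> 0\<close> to the argument cannot decrease the outer function, while by subhomogeneity it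
  adds at most its value at \<open>l\<close>.\<close>

lemma subhomogeneous_nonneg:
  assumes S: "subhomogeneous_on S F" "z \<in> S"
    and mono: "\<And>x u v. u \<le> v \<Longrightarrow> F (x, u) \<le> F (x, v)"
    and l: "l \<ge> 0"
  shows "F (z, l) \<ge> 0"
proof -
  have "F (z, 0) \<le> F (z, l)"
    using l by (rule mono)
  moreover have "F (z, 0) \<ge> 0"
  proof -
    have fin: "\<bar>F (z, 0)\<bar> \<noteq> \<infinity>"
      using S unfolding subhomogeneous_on_def by simp
    \<comment> \<open>finiteness turns \<open>F (z, 0) \<le> 2 F (z, 0)\<close> into nonnegativity\<close>
    have "F (z, 0 + 1 *\<^sub>R 0) \<le> F (z, 0) + ereal 1 * F (z, 0)"
      using S zero_le_one unfolding subhomogeneous_on_def by blast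
    with fin show ?thesis
      by (cases "F (z, 0)") auto
  qed
  ultimately show ?thesis by simp
qed

section \<open>Convergence rate\<close>

text \<open>The model replaces the objective twice: at the new iterate, and at the competitor
  \<open>x + \<gamma> (v - x)\<close>, which is feasible because it corresponds to \<open>v\<close>.  Both lie in the domain of the
  objective and within \<open>\<gamma> R\<close> of \<open>x\<close>, so each replacement costs \<open>\<gamma>\<^sup>3 R\<^sup>3 K / 6\<close>.\<close>

lemma contracting_Newton_step:
  fixes F :: "'a::euclidean_space \<times> (real ^ 'm) \<Rightarrow> ereal"
  assumes B: "self_adjoint_pos_def B"
    and F: "closed_convex_ereal F"
    and mono: "\<And>x u v. u \<le> v \<Longrightarrow> F (x, u) \<le> F (x, v)"
    and D: "open D" "convex D"
    and f: "\<And>i. convex_on D (\<lambda>x. f x $ i)"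
    and C2: "\<And>i. twice_continuously_differentiable_on D (\<lambda>x. f x $ i) (grad i) (hess i)"
    and Lip: "\<And>i x y. x \<in> D \<Longrightarrow> y \<in> D \<Longrightarrow>
          B_opnorm B (hess i x - hess i y) \<le> l $ i * B_norm B (x - y)"
    and sub: "subhomogeneous_on (composite_dom F D f) F"
    and K: "\<And>z. z \<in> composite_dom F D f \<Longrightarrow> F (z, l) \<le> ereal K"
    and R: "\<And>y z. y \<in> composite_dom F D f \<Longrightarrow> z \<in> composite_dom F D f \<Longrightarrow> B_norm B (y - z) \<le> R"
    and g: "0 < g" "g \<le> 1"
    and x: "x \<in> composite_dom F D f" "F (x, f x) \<le> ereal a"
    and v: "v \<in> composite_dom F D f" "F (v, f v) \<le> ereal b"
    and step: "is_arg_min (\<lambda>y. F (y, Omega2 f grad hess x y))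
                 (\<lambda>y. x + (1 / g) *\<^sub>R (y - x) \<in> composite_dom F D f) x'"
  shows "x' \<in> composite_dom F D f"
    and "F (x', f x') \<le> ereal ((1 - g) * a + g * b + g ^ 3 * (K * R ^ 3) / 3)"
proof -
  let ?S = "composite_dom F D f"
  have S_D: "z \<in> D" if "z \<in> ?S" for z
    using that by (simp add: composite_dom_def)
  have l0: "l \<ge> 0"
    using Lipschitz_constant_nonneg[OF B D(1) _ Lip] S_D[OF x(1)] by (auto simp: less_eq_vec_def)
  \<comment> \<open>the error of the model at any feasible point is at most \<open>t *\<^sub>R l\<close>\<close>
  define t where "t = (g * R) ^ 3 / 6"
  have R0: "0 \<le> R"
    using B_norm_nonneg[OF B] R[OF x(1) x(1)] order_trans by blast
  have t0: "0 \<le> t"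
    using R0 g by (simp add: t_def)
  have contract: "x + g *\<^sub>R (w - x) = (1 - g) *\<^sub>R x + g *\<^sub>R w" for w
    by (simp add: algebra_simps)
  have feasible: "x + g *\<^sub>R (w - x) \<in> ?S" if "w \<in> ?S" for w
    unfolding contract using g that x(1)
    by (intro convexD_alt convex_composite_dom[OF F mono D(2) f]) auto
  have model: "f y \<le> Omega2 f grad hess x y + t *\<^sub>R l" "Omega2 f grad hess x y \<le> f y + t *\<^sub>R l"
    if w: "w \<in> ?S" and y: "y = x + g *\<^sub>R (w - x)" for w y
  proof -
    have "B_norm B (y - x) = g * B_norm B (w - x)"
      using g by (simp add: y B_norm_scaleR)
    also have "\<dots> \<le> g * R"
      using R[OF w x(1)] g by simp
    finally have "B_norm B (y - x) ^ 3 / 6 \<le> t"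
      unfolding t_def by (intro divide_right_mono power_mono B_norm_nonneg[OF B]) auto
    then have le: "l $ i * B_norm B (y - x) ^ 3 / 6 \<le> t * l $ i" for i
      using l0 mult_left_mono[of "B_norm B (y - x) ^ 3 / 6" t "l $ i"]
      by (simp add: less_eq_vec_def mult.commute)
    have "\<bar>f y $ i - Omega2 f grad hess x y $ i\<bar> \<le> t * l $ i" for i
      using second_order_Taylor_error[OF B D(2) C2[of i] Lip[of _ _ i], of x y] S_D[OF x(1)]
        S_D[OF feasible[OF w]] le[of i] by (simp add: Omega2_def y)
    then show "f y \<le> Omega2 f grad hess x y + t *\<^sub>R l" "Omega2 f grad hess x y \<le> f y + t *\<^sub>R l"
      by (simp_all add: less_eq_vec_def abs_le_iff algebra_simps)
  qed
  define w where "w = x + (1 / g) *\<^sub>R (x' - x)"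
  have w: "w \<in> ?S"
    using step by (simp add: is_arg_min_def w_def)
  have x'_eq: "x' = x + g *\<^sub>R (w - x)"
    using g by (simp add: w_def)
  show x': "x' \<in> ?S"
    using feasible[OF w] by (simp add: x'_eq)
  define y where "y = x + g *\<^sub>R (v - x)"
  have y: "y \<in> ?S"
    using feasible[OF v(1)] by (simp add: y_def)
  have "F (y, f y) \<le> ereal ((1 - g) * a + g * b)"
    unfolding y_def contract using x v g
    by (intro composite_convex[OF F mono f]) (auto simp: S_D)
  then have "F (y, Omega2 f grad hess x y) \<le> ereal ((1 - g) * a + g * b + t * K)"
    using subhomogeneous_perturbation[OF sub y mono model(2)[OF v(1) y_def] t0 _ K[OF y]] by blast
  moreover have "F (x', Omega2 f grad hess x x') \<le> F (y, Omega2 f grad hess x y)"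
    using step v(1) g by (auto simp: is_arg_min_def y_def not_less)
  ultimately have "F (x', Omega2 f grad hess x x') \<le> ereal ((1 - g) * a + g * b + t * K)"
    by (rule order_trans[rotated])
  then have "F (x', f x') \<le> ereal ((1 - g) * a + g * b + t * K + t * K)"
    using subhomogeneous_perturbation[OF sub x' mono model(1)[OF w x'_eq] t0 _ K[OF x']] by blast
  moreover have "t * K + t * K = g ^ 3 * (K * R ^ 3) / 3"
    by (simp add: t_def power_mult_distrib)
  ultimately show "F (x', f x') \<le> ereal ((1 - g) * a + g * b + g ^ 3 * (K * R ^ 3) / 3)"
    by (simp only: add.assoc)
qed

text \<open>After multiplication by \<open>(k + 1) (k + 2) (k + 3)\<close> the recursion says that
  \<open>k (k + 1) (k + 2) \<delta>\<^sub>k\<close> grows by \<open>9 C (k + 1) (k + 2) / (k + 3)\<^sup>2 \<le> 9 C\<close> in each step, and the case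
  \<open>k = 0\<close> of the weighted claim is trivial.\<close>

lemma contracting_recursion:
  fixes \<delta> :: "nat \<Rightarrow> real"
  assumes C: "C \<ge> 0"
    and step: "\<And>k. \<delta> (Suc k) \<le> (1 - 3 / (real k + 3)) * \<delta> k + (3 / (real k + 3)) ^ 3 * C / 3"
    and k: "k \<ge> 1"
  shows "\<delta> k \<le> 9 * C / (real k)\<^sup>2"
proof -
  have weighted: "real n * (real n + 1) * (real n + 2) * \<delta> n \<le> 9 * C * real n" for n
  proof (induction n)
    case (Suc n)
    define m where "m = real n"
    have m: "m \<ge> 0" by (simp add: m_def)
    have "(m + 1) * (m + 2) * (m + 3) * \<delta> (Suc n)
        \<le> (m + 1) * (m + 2) * (m + 3) * ((1 - 3 / (m + 3)) * \<delta> n + (3 / (m + 3)) ^ 3 * C / 3)"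
      using step[of n] m by (intro mult_left_mono) (auto simp: m_def)
    also have "\<dots> = m * (m + 1) * (m + 2) * \<delta> n + 9 * C * ((m + 1) * (m + 2) / (m + 3)\<^sup>2)"
    proof -
      have r: "(m + 3) * (1 - 3 / (m + 3)) = m" "(m + 3) * ((3 / (m + 3)) ^ 3 * C / 3) = 9 * C / (m + 3)\<^sup>2"
        using m by (simp_all add: divide_simps power2_eq_square power3_eq_cube)
      have "(m + 1) * (m + 2) * (m + 3) * ((1 - 3 / (m + 3)) * \<delta> n + (3 / (m + 3)) ^ 3 * C / 3)
          = (m + 1) * (m + 2) * (((m + 3) * (1 - 3 / (m + 3))) * \<delta> n
              + (m + 3) * ((3 / (m + 3)) ^ 3 * C / 3))"
        by algebra
      then show ?thesis
        unfolding r by (simp add: algebra_simps)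
    qed
    also have "(m + 1) * (m + 2) / (m + 3)\<^sup>2 \<le> 1"
      using m by (intro divide_le_eq_1_pos[THEN iffD2] zero_less_power)
          (simp_all add: power2_eq_square algebra_simps)
    then have "m * (m + 1) * (m + 2) * \<delta> n + 9 * C * ((m + 1) * (m + 2) / (m + 3)\<^sup>2)
        \<le> 9 * C * m + 9 * C * 1"
      using Suc C unfolding m_def by (intro add_mono mult_left_mono) auto
    finally show ?case
      by (simp add: m_def algebra_simps)
  qed simp
  define m where "m = real k"
  have m: "m > 0" using k by (simp add: m_def)
  have "m * ((m + 1) * (m + 2) * \<delta> k) \<le> m * (9 * C)"
    using weighted[of k] by (simp add: m_def mult_ac)
  then have "(m + 1) * (m + 2) * \<delta> k \<le> 9 * C"
    using m by (simp only: mult_le_cancel_left_pos)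
  moreover have "0 < (m + 1) * (m + 2)"
    using m by simp
  ultimately have "\<delta> k \<le> 9 * C / ((m + 1) * (m + 2))"
    by (simp only: pos_le_divide_eq mult.commute[of "\<delta> k"])
  also have "\<dots> \<le> 9 * C / m\<^sup>2"
  proof (rule divide_left_mono)
    show "m\<^sup>2 \<le> (m + 1) * (m + 2)"
      using m by (simp add: power2_eq_square algebra_simps)
  qed (use m C in simp_all)
  finally show ?thesis by (simp add: m_def)
qed

theorem theorem10:
  fixes B :: "'a::euclidean_space \<Rightarrow>\<^sub>L 'a \<Rightarrow>\<^sub>L real"
    and F :: "'a \<times> (real ^ 'm) \<Rightarrow> ereal"
    and D :: "'a set"
    and f :: "'a \<Rightarrow> real ^ 'm"
    and grad :: "'m \<Rightarrow> 'a \<Rightarrow> 'a \<Rightarrow>\<^sub>L real"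
    and hess :: "'m \<Rightarrow> 'a \<Rightarrow> 'a \<Rightarrow>\<^sub>L 'a \<Rightarrow>\<^sub>L real"
    and L2 :: "real ^ 'm"
    and FL2 diam :: ereal
    and \<phi> :: "'a \<Rightarrow> ereal"
    and dom\<phi> :: "'a set"
    and xstar :: 'a
    and x :: "nat \<Rightarrow> 'a"
    and \<gamma> :: "nat \<Rightarrow> real"
  assumes B: "self_adjoint_pos_def B"
    and F_closed_convex: "closed_convex_ereal F"
    and F_mono: "\<And>x u v. u \<le> v \<Longrightarrow> F (x, u) \<le> F (x, v)"
    and D: "open D" "convex D"
    and f_convex: "\<And>i. convex_on D (\<lambda>x. f x $ i)"
    and f_closed: "\<And>i. closed (epigraph D (\<lambda>x. f x $ i))"
    and f_C2: "\<And>i. twice_continuously_differentiable_on D (\<lambda>x. f x $ i) (grad i) (hess i)"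
    and f_Lipschitz: "\<And>i x y. x \<in> D \<Longrightarrow> y \<in> D \<Longrightarrow>
          B_opnorm B (hess i x - hess i y) \<le> L2 $ i * B_norm B (x - y)"
    and \<phi>_eq: "\<phi> = composite F D f"
    and dom\<phi>_eq: "dom\<phi> = composite_dom F D f"
    and subhomogeneous: "subhomogeneous_on dom\<phi> F"
    and minimizer: "is_arg_min \<phi> (\<lambda>x. x \<in> dom\<phi>) xstar"
    and FL2_eq: "FL2 = (SUP x\<in>dom\<phi>. F (x, L2))"
    and FL2_finite: "FL2 < \<infinity>"
    and diam_eq: "diam = B_diameter B dom\<phi>"
    and diam_finite: "diam < \<infinity>"
    and \<gamma>_eq: "\<And>k. \<gamma> k = 3 / (real k + 3)"
    and x_0: "x 0 \<in> dom\<phi>"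
    and x_Suc: "\<And>k. is_arg_min (\<lambda>y. F (y, Omega2 f grad hess (x k) y))
                       (\<lambda>y. x k + (1 / \<gamma> k) *\<^sub>R (y - x k) \<in> dom\<phi>) (x (Suc k))"
  shows "\<forall>k\<ge>1. \<phi> (x k) - \<phi> xstar \<le> 9 * FL2 * diam ^ 3 / ereal ((real k)\<^sup>2)"
proof (intro allI impI)
  fix k :: nat assume k: "1 \<le> k"
  have xs: "xstar \<in> dom\<phi>"
    using minimizer by (simp add: is_arg_min_def)
  have \<phi>_val: "\<phi> z = F (z, f z)" if "z \<in> dom\<phi>" for z
    using that by (simp add: \<phi>_eq dom\<phi>_eq composite_def composite_dom_def)
  have fin: "\<bar>F (z, u)\<bar> \<noteq> \<infinity>" if "z \<in> dom\<phi>" for z u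
    using subhomogeneous that unfolding subhomogeneous_on_def by simp
  have D_ne: "D \<noteq> {}"
    using xs by (auto simp: dom\<phi>_eq composite_dom_def)
  have L2: "L2 \<ge> 0"
    using Lipschitz_constant_nonneg[OF B D(1) D_ne f_Lipschitz] by (auto simp: less_eq_vec_def)
  have F_L2_le: "F (z, L2) \<le> FL2" if "z \<in> dom\<phi>" for z
    unfolding FL2_eq using that by (rule SUP_upper)
  have "FL2 \<ge> 0"
    using subhomogeneous_nonneg[OF subhomogeneous xs F_mono L2] F_L2_le[OF xs] by (rule order_trans)
  then obtain K where K: "FL2 = ereal K" "K \<ge> 0"
    using FL2_finite by (cases FL2) auto
  have diam_ge: "ereal (B_norm B (y - z)) \<le> diam" if "y \<in> dom\<phi>" "z \<in> dom\<phi>" for y z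
    unfolding diam_eq B_diameter_def using that by (meson SUP_upper2 order_refl)
  have "0 \<le> diam"
    using diam_ge[OF xs xs] by (simp add: B_norm_def zero_ereal_def)
  then obtain R where R: "diam = ereal R" "R \<ge> 0"
    using diam_finite by (cases diam) auto
  define b where "b = real_of_ereal (\<phi> xstar)"
  define \<delta> where "\<delta> = (\<lambda>k. real_of_ereal (\<phi> (x k)) - b)"
  have real_val: "F (z, f z) = ereal (real_of_ereal (\<phi> z))" if "z \<in> dom\<phi>" for z
    using fin[OF that] \<phi>_val[OF that] by (simp add: ereal_real)
  have \<gamma>01: "0 < \<gamma> n" "\<gamma> n \<le> 1" for n
    by (simp_all add: \<gamma>_eq)
  have step: "x (Suc n) \<in> dom\<phi> \<and> F (x (Suc n), f (x (Suc n)))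
      \<le> ereal ((1 - \<gamma> n) * real_of_ereal (\<phi> (x n)) + \<gamma> n * b + \<gamma> n ^ 3 * (K * R ^ 3) / 3)"
    if "x n \<in> dom\<phi>" for n
  proof -
    have val: "F (x n, f (x n)) \<le> ereal (real_of_ereal (\<phi> (x n)))" "F (xstar, f xstar) \<le> ereal b"
      using real_val[OF that] real_val[OF xs] by (simp_all add: b_def)
    have KR: "F (z, L2) \<le> ereal K" "B_norm B (y - z) \<le> R" if "z \<in> dom\<phi>" "y \<in> dom\<phi>" for y z
      using F_L2_le[OF that(1)] diam_ge[OF that(2,1)] K R by auto
    show ?thesis
      using contracting_Newton_step[OF B F_closed_convex F_mono D f_convex f_C2 f_Lipschitz
          subhomogeneous[unfolded dom\<phi>_eq] _ _ \<gamma>01 that[unfolded dom\<phi>_eq] val(1)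
          xs[unfolded dom\<phi>_eq] val(2) x_Suc[unfolded dom\<phi>_eq]]
        KR unfolding dom\<phi>_eq by blast
  qed
  have dom: "x n \<in> dom\<phi>" for n
    by (induction n) (use x_0 step in auto)
  have "\<delta> k \<le> 9 * (K * R ^ 3) / (real k)\<^sup>2"
  proof (rule contracting_recursion[OF _ _ k])
    fix n
    have "real_of_ereal (\<phi> (x (Suc n)))
        \<le> (1 - \<gamma> n) * real_of_ereal (\<phi> (x n)) + \<gamma> n * b + \<gamma> n ^ 3 * (K * R ^ 3) / 3"
      using step[OF dom[of n]] unfolding real_val[OF dom] by simp
    then have "\<delta> (Suc n) \<le> (1 - \<gamma> n) * \<delta> n + \<gamma> n ^ 3 * (K * R ^ 3) / 3"
      by (simp add: \<delta>_def algebra_simps)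
    then show "\<delta> (Suc n) \<le> (1 - 3 / (real n + 3)) * \<delta> n + (3 / (real n + 3)) ^ 3 * (K * R ^ 3) / 3"
      by (simp only: \<gamma>_eq)
  qed (use K R in simp)
  moreover have "\<phi> (x k) - \<phi> xstar = ereal (\<delta> k)"
  proof -
    have "\<phi> (x k) = ereal (\<delta> k + b)" "\<phi> xstar = ereal b"
      using real_val[OF dom[of k]] real_val[OF xs] \<phi>_val[OF dom[of k]] \<phi>_val[OF xs]
      by (simp_all add: \<delta>_def b_def)
    then show ?thesis by simp
  qed
  moreover have "9 * FL2 * diam ^ 3 / ereal ((real k)\<^sup>2) = ereal (9 * (K * R ^ 3) / (real k)\<^sup>2)"
  proof -
    have "9 * FL2 * diam ^ 3 = ereal 9 * ereal K * ereal R ^ 3"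
      using K R by simp
    then show ?thesis
      using k by (simp add: mult.assoc)
  qed
  ultimately show "\<phi> (x k) - \<phi> xstar \<le> 9 * FL2 * diam ^ 3 / ereal ((real k)\<^sup>2)"
    by simp
qed

end
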